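(* Let $\{\sigma_n\}_{n\in\mathbb{N}}\subset(-d,0)$ and $\{r_n\}_{n\in\mathbb{N}}\subset(0,+\infty)$ be such that $\sigma_n\to0^-$ and $r_n\to0^+$. Let $U\subset\mathbb{R}^d$ be an open bounded set and let $\{E_n\}_{n\in\mathbb{N}}\subset\mathcal{M}_{\mathrm f}(\mathbb{R}^d)$ be such that $E_n\subset U$ for all $n\in\mathbb{N}$. Let $C>0$. If $\hat J^{\sigma_n}_{r_n}(E_n)\le C$ for all $n\in\mathbb{N}$, then, up to a subsequence, $\chi_{E_n}\to\chi_E$ in $L^1(\mathbb{R}^d)$ for some $E\in\mathcal{M}_{\mathrm f}(\mathbb{R}^d)$. In particular, if $\hat J^{\sigma_n}(E_n)\le C$ for all $n\in\mathbb{N}$, then, up to a subsequence, $\chi_{E_n}\to\chi_E$ in $L^1(\mathbb{R}^d)$ for some $E\in\mathcal{M}_{\mathrm f}(\mathbb{R}^d)$.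
   Context: Let $d\ge1$, let $|E|$ denote Lebesgue measure in $\mathbb{R}^d$, $\omega_d$ the measure of the unit ball, $B_\rho(x)$ the ball of radius $\rho$ and center $x$, and $\chi_E$ the characteristic function of $E$. $\mathcal{M}_{\mathrm f}(\mathbb{R}^d)$ is the family of measurable sets $E\subset\mathbb{R}^d$ with $|E|<+\infty$. For $\sigma\in(-d,0)$, $r>0$ and $E\in\mathcal{M}_{\mathrm f}(\mathbb{R}^d)$ set $$\gamma^\sigma_r:=d\omega_d\frac{1-r^{-\sigma}}{\sigma},\qquad \hat J^\sigma_r(E):=-\int_E\int_{E\setminus B_r(x)}\frac{1}{|x-y|^{d+\sigma}}\,dy\,dx-\gamma^\sigma_r|E|,$$ $$\hat J^\sigma(E):=-\int_E\int_E\frac{1}{|x-y|^{d+\sigma}}\,dy\,dx-\frac{d\omega_d}{\sigma}|E|.$$ *)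

theory Defs
  imports "HOL-Analysis.Analysis"
begin

text \<open>The space is an arbitrary Euclidean space \<open>'a\<close> with \<open>d = DIM('a)\<close>; \<open>\<omega>\<^sub>d\<close> is the library's
  \<^const>\<open>unit_ball_vol\<close>, and the family of measurable sets of finite measure is \<^const>\<open>lmeasurable\<close>.\<close>

lemma unit_ball_vol_eq_measure:
  "unit_ball_vol (real DIM('a)) = measure lebesgue (ball (0 :: 'a :: euclidean_space) 1)"
  by (simp add: content_ball)

definition gamma_coeff :: "nat \<Rightarrow> real \<Rightarrow> real \<Rightarrow> real" where
  "gamma_coeff d \<sigma> r = real d * unit_ball_vol (real d) * ((1 - r powr (- \<sigma>)) / \<sigma>)"

text \<open>For \<open>-d < \<sigma> < 0\<close> and \<open>E\<close> of finite measure all the integrals below are finite, so that the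
  Bochner integral is the ordinary Lebesgue integral of a nonnegative function. On the diagonal
  \<open>x = y\<close>, a null set, the kernel has the value \<open>0\<close> because \<open>1 / 0 = 0\<close>.\<close>

definition J_hat_core :: "real \<Rightarrow> real \<Rightarrow> 'a::euclidean_space set \<Rightarrow> real" where
  "J_hat_core \<sigma> r E =
     - (LINT x:E|lebesgue. LINT y:(E - ball x r)|lebesgue.
          1 / norm (x - y) powr (real DIM('a) + \<sigma>))
     - gamma_coeff DIM('a) \<sigma> r * measure lebesgue E"

definition J_hat :: "real \<Rightarrow> 'a::euclidean_space set \<Rightarrow> real" where
  "J_hat \<sigma> E =
     - (LINT x:E|lebesgue. LINT y:E|lebesgue.
          1 / norm (x - y) powr (real DIM('a) + \<sigma>))
     - real DIM('a) * unit_ball_vol (real DIM('a)) / \<sigma> * measure lebesgue E"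

end

theory Submission
  imports Defs "HOL-Complex_Analysis.Great_Picard" "HOL-Library.Diagonal_Subsequence"
    "HOL-Real_Asymp.Real_Asymp"
begin

text \<open>The number \<open>-\<gamma>\<^sub>r\<^sup>\<sigma>\<close> is the integral of \<open>K\<^sub>\<sigma>(z) = |z|\<^bsup>-d-\<sigma>\<^esup>\<close> over the annulus \<open>r \<le> |z| < 1\<close>.
  Therefore an upper bound on the functional controls, up to \<open>|E|\<^sup>2\<close> for the pairs at distance at
  least \<open>1\<close>, the interaction of \<open>E\<close> with its complement through this truncated kernel. For \<open>\<sigma> \<rightarrow> 0\<close> and
  \<open>r \<rightarrow> 0\<close> it thus controls the interaction through every fixed continuous kernel \<open>h \<le> |z|\<^bsup>-d\<^esup>/2\<close>
  supported in some \<open>\<delta> \<le> |z| < 1\<close>, with a constant independent of \<open>h\<close>. Since \<open>|z|\<^bsup>-d\<^esup>\<close> is not integrable at the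
  origin, \<open>H = \<integral>h\<close> can be taken arbitrarily large, so that \<open>\<chi>\<^sub>E\<close> is within \<open>O(1/H)\<close> in \<open>L\<^sup>1\<close> of
  \<open>(\<chi>\<^sub>E * h)/H\<close>; for fixed \<open>h\<close> these convolutions are equicontinuous and Arzela-Ascoli applies. Hence
  the sequence is totally bounded in \<open>L\<^sup>1\<close>. The untruncated functional is the case \<open>r = 0\<close>.\<close>

section \<open>Convergence of characteristic functions\<close>

text \<open>A point lying in none of the \<open>D (n + i)\<close> never changes its membership from
  stage \<open>n\<close> on, so there \<open>A n\<close> agrees with the limsup set
  \<open>F\<close>. Hence \<open>A n\<close> and \<open>F\<close> differ only inside the tail union
  of the \<open>D\<close>, whose measure is at most a geometric tail. The common superset
  \<open>S\<close> keeps \<open>F\<close> of finite measure.\<close>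

lemma fmeasurable_symdiff_Cauchy_limit:
  fixes A :: "nat \<Rightarrow> 'a set"
  assumes A: "\<And>k. A k \<in> fmeasurable M" and S: "S \<in> fmeasurable M" "\<And>k. A k \<subseteq> S"
    and Cauchy: "\<And>k. measure M (sym_diff (A k) (A (Suc k))) \<le> (1 / 2) ^ k"
  obtains F where "F \<in> fmeasurable M"
    "(\<lambda>k. LINT x|M. \<bar>indicat_real (A k) x - indicat_real F x\<bar>) \<longlonglongrightarrow> 0"
proof -
  define F where "F = (\<Inter>n. \<Union>k\<in>{n..}. A k)"
  have sA [measurable]: "A k \<in> sets M" for k using A[of k] by (rule fmeasurableD)
  have sF [measurable]: "F \<in> sets M" unfolding F_def by measurable
  have "F \<subseteq> S" unfolding F_def using S(2) by blast
  then have F: "F \<in> fmeasurable M" using S(1) sF by (simp add: fmeasurableI2)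
  define D where "D k = sym_diff (A k) (A (Suc k))" for k
  have D: "D k \<in> fmeasurable M" for k using A unfolding D_def by blast
  have walk: "x \<in> A n \<longleftrightarrow> x \<in> A (n + m)" if "\<And>i. x \<notin> D (n + i)" for x n m
  proof (induction m)
    case (Suc m)
    then show ?case using that[of m] by (auto simp: D_def)
  qed simp
  have sub: "sym_diff (A n) F \<subseteq> (\<Union>i. D (n + i))" for n
  proof (rule ccontr)
    assume "\<not> sym_diff (A n) F \<subseteq> (\<Union>i. D (n + i))"
    then obtain x where x: "x \<in> sym_diff (A n) F" "\<And>i. x \<notin> D (n + i)" by blast
    have tail: "x \<in> A n \<longleftrightarrow> x \<in> A k" if "n \<le> k" for k
      using walk[OF x(2), of "k - n"] that by simp
    have "x \<in> F \<longleftrightarrow> x \<in> A n"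
    proof
      assume "x \<in> F"
      then show "x \<in> A n" using tail unfolding F_def by auto
    next
      assume *: "x \<in> A n"
      show "x \<in> F" unfolding F_def
      proof
        fix m
        have "x \<in> A (max m n)" using * tail[of "max m n"] by simp
        then show "x \<in> (\<Union>k\<in>{m..}. A k)" by (intro UN_I[of "max m n"]) auto
      qed
    qed
    with x(1) show False by blast
  qed
  have bound: "measure M (sym_diff (A n) F) \<le> 2 * (1 / 2) ^ n" for n
  proof -
    have "emeasure M (sym_diff (A n) F) \<le> emeasure M (\<Union>i. D (n + i))"
      using D by (intro emeasure_mono sub sets.countable_UN) (auto simp: fmeasurableD)
    also have "\<dots> \<le> (\<Sum>i. emeasure M (D (n + i)))"
      using D by (intro emeasure_subadditive_countably) (auto simp: fmeasurableD)
    also have "\<dots> \<le> (\<Sum>i. ennreal ((1 / 2) ^ n * (1 / 2) ^ i))"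
      using D Cauchy by (intro suminf_le) (auto simp: emeasure_eq_measure2 D_def power_add[symmetric] simp del: power_one_over intro!: ennreal_leI)
    also have "\<dots> = ennreal (\<Sum>i. (1 / 2) ^ n * (1 / 2) ^ i)"
      by (intro suminf_ennreal_eq summable_sums summable_mult) (auto simp: summable_geometric)
    also have "(\<Sum>i. (1 / 2 :: real) ^ n * (1 / 2) ^ i) = 2 * (1 / 2) ^ n"
      by (subst suminf_mult) (auto simp: suminf_geometric summable_geometric)
    finally show ?thesis
      by (subst (asm) emeasure_eq_measure2) (use A F in \<open>auto simp del: power_one_over\<close>)
  qed
  have "(LINT x|M. \<bar>indicat_real (A k) x - indicat_real F x\<bar>) = measure M (sym_diff (A k) F)" for k
  proof -
    have "(LINT x|M. \<bar>indicat_real (A k) x - indicat_real F x\<bar>) = (LINT x|M. indicat_real (sym_diff (A k) F) x)"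
      by (intro Bochner_Integration.integral_cong) (auto simp: indicator_def)
    also have "\<dots> = measure M (sym_diff (A k) F)"
      using sets.sets_into_space[of "sym_diff (A k) F" M] by (simp add: Int_absorb2)
    finally show ?thesis .
  qed
  moreover have "(\<lambda>k. measure M (sym_diff (A k) F)) \<longlonglongrightarrow> 0"
  proof (rule tendsto_sandwich[OF _ _ tendsto_const])
    show "(\<lambda>n. 2 * (1 / 2 :: real) ^ n) \<longlonglongrightarrow> 0"
      by (intro tendsto_mult_right_zero LIMSEQ_power_zero) simp
  qed (use bound in auto)
  ultimately show thesis using F that by simp
qed

text \<open>Diagonal argument: at stage \<open>n\<close> total boundedness refines the current
  subsequence until all pairwise distances are at most \<open>(1/2) ^ n\<close>. The diagonal
  sequence then has summable consecutive distances.\<close>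

lemma fmeasurable_totally_bounded_imp_convergent_subseq:
  fixes A :: "nat \<Rightarrow> 'a set"
  assumes A: "\<And>k. A k \<in> fmeasurable M" and S: "S \<in> fmeasurable M" "\<And>k. A k \<subseteq> S"
    and tb: "\<And>e (s :: nat \<Rightarrow> nat). 0 < e \<Longrightarrow> strict_mono s \<Longrightarrow>
      \<exists>r. strict_mono (r :: nat \<Rightarrow> nat) \<and> (\<forall>i j. measure M (sym_diff (A (s (r i))) (A (s (r j)))) \<le> e)"
  obtains \<phi> F where "strict_mono (\<phi> :: nat \<Rightarrow> nat)" "F \<in> fmeasurable M"
    "(\<lambda>k. LINT x|M. \<bar>indicat_real (A (\<phi> k)) x - indicat_real F x\<bar>) \<longlonglongrightarrow> 0"
proof -
  define P where "P n s \<longleftrightarrow> (\<forall>i j. measure M (sym_diff (A (s i)) (A (s j))) \<le> (1 / 2) ^ n)"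
    for n :: nat and s :: "nat \<Rightarrow> nat"
  interpret subseqs P
  proof
    fix n and s :: "nat \<Rightarrow> nat" assume "strict_mono s"
    with tb[of "(1 / 2) ^ n" s] show "\<exists>r'. strict_mono r' \<and> P n (s \<circ> r')"
      unfolding P_def o_def by simp
  qed
  have diag: "P k (diagseq \<circ> ((+) (Suc k)))" for k
    by (rule diagseq_holds) (auto simp: P_def)
  have P_D: "P n s \<Longrightarrow> measure M (sym_diff (A (s i)) (A (s j))) \<le> (1 / 2) ^ n" for n s i j
    by (simp add: P_def)
  \<comment> \<open>Stage \<open>k\<close> controls the diagonal sequence only from index
    \<open>k + 1\<close> on. After the shift by \<open>Suc\<close>, the terms
    \<open>\<phi> k\<close> and \<open>\<phi> (Suc k)\<close> are entries 0 and 1 of that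
    tail.\<close>
  define \<phi> where "\<phi> = diagseq \<circ> Suc"
  have \<phi>: "strict_mono \<phi>"
    unfolding \<phi>_def using subseq_diagseq by (auto simp: strict_mono_def)
  have "measure M (sym_diff (A (\<phi> k)) (A (\<phi> (Suc k)))) \<le> (1 / 2) ^ k" for k
    using P_D[OF diag[of k], of 0 1] by (simp add: \<phi>_def)
  from fmeasurable_symdiff_Cauchy_limit[where A = "\<lambda>k. A (\<phi> k)", OF A S this]
  show thesis using \<phi> that by blast
qed

section \<open>Convolutions of characteristic functions with a bounded continuous kernel\<close>

lemma set_lebesgue_integral_norm_diff_le:
  fixes f g :: "'a::euclidean_space \<Rightarrow> real"
  assumes A: "A \<in> fmeasurable M"
    and int: "set_integrable M A f" "set_integrable M A g"
    and le: "\<And>x. x \<in> A \<Longrightarrow> \<bar>f x - g x\<bar> \<le> e"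
  shows "\<bar>(LINT x:A|M. f x) - (LINT x:A|M. g x)\<bar> \<le> e * measure M A"
proof -
  have "(LINT x:A|M. f x) - (LINT x:A|M. g x) = (LINT x|M. indicator A x *\<^sub>R (f x - g x))"
    using int by (subst set_integral_diff(2)[symmetric]) (auto simp: set_lebesgue_integral_def)
  also have "norm \<dots> \<le> (LINT x|M. indicator A x * e)"
  proof (rule Bochner_Integration.integral_norm_bound_integral)
    show "integrable M (\<lambda>x. indicat_real A x * e)"
      using A by (auto simp: fmeasurable_def)
    show "integrable M (\<lambda>x. indicat_real A x *\<^sub>R (f x - g x))"
      using set_integral_diff(1)[OF int] by (simp add: set_integrable_def)
  qed (use le in \<open>auto simp: indicator_def\<close>)
  also have "\<dots> = e * measure M A"
    using sets.sets_into_space[of A M] A by (simp add: Int_absorb2 fmeasurableD)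
  finally show ?thesis by simp
qed

lemma convolution_integrable:
  fixes h :: "'a::euclidean_space \<Rightarrow> real"
  assumes h: "continuous_on UNIV h" "\<And>z. \<bar>h z\<bar> \<le> B" and A: "A \<in> lmeasurable"
  shows "set_integrable lebesgue A (\<lambda>y. h (x - y))"
proof -
  have "continuous_on UNIV (\<lambda>y. h (x - y))"
    by (rule continuous_on_compose2[OF h(1)]) (auto intro!: continuous_intros)
  then have [measurable]: "(\<lambda>y. h (x - y)) \<in> borel_measurable lebesgue"
    by (intro measurable_completion) (simp add: borel_measurable_continuous_onI)
  have "integrable lebesgue (\<lambda>y. indicator A y * B)"
    using A by (auto simp: fmeasurable_def)
  then show ?thesis
    unfolding set_integrable_def
  proof (rule Bochner_Integration.integrable_bound)
    show "(\<lambda>y. indicat_real A y *\<^sub>R h (x - y)) \<in> borel_measurable lebesgue"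
      using A by (intro borel_measurable_scaleR) auto
  qed (use h(2) in \<open>auto simp: indicator_def intro!: AE_I2 order_trans[OF h(2)]\<close>)
qed

text \<open>On the compact set of differences of points of \<open>S\<close> the kernel is uniformly
  continuous, so the convolutions are equicontinuous on \<open>S\<close>; they are bounded by
  \<open>B\<close> times the measure of \<open>S\<close>. Arzela-Ascoli gives a uniformly convergent
  subsequence, and dropping its first terms makes the estimate hold for all pairs of
  indices.\<close>

lemma convolution_convergent_subseq:
  fixes h :: "'a::euclidean_space \<Rightarrow> real" and A :: "nat \<Rightarrow> 'a set"
  assumes h: "continuous_on UNIV h" "\<And>z. \<bar>h z\<bar> \<le> B"
    and A: "\<And>n. A n \<in> lmeasurable" and S: "compact S" "\<And>n. A n \<subseteq> S" and e: "0 < e"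
  obtains k :: "nat \<Rightarrow> nat" where "strict_mono k"
    "\<And>i j x. x \<in> S \<Longrightarrow> \<bar>(LINT y:A (k i)|lebesgue. h (x - y)) - (LINT y:A (k j)|lebesgue. h (x - y))\<bar> \<le> e"
proof -
  define G where "G n x = (LINT y:A n|lebesgue. h (x - y))" for n x
  define V where "V = measure lebesgue S"
  have Sm: "S \<in> lmeasurable" using S(1) by (rule lmeasurable_compact)
  have V: "measure lebesgue (A n) \<le> V" for n
    unfolding V_def using A S(2) Sm by (intro measure_mono_fmeasurable) (auto simp: fmeasurableD)
  have V0: "0 \<le> V" by (simp add: V_def)
  have int: "set_integrable lebesgue (A n) (\<lambda>y. h (x - y))" for n x
    by (rule convolution_integrable[OF h A])
  have bound: "norm (G n x) \<le> B * V" for n x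
  proof -
    have "\<bar>(LINT y:A n|lebesgue. h (x - y)) - (LINT y:A n|lebesgue. 0)\<bar> \<le> B * measure lebesgue (A n)"
      using h(2) by (intro set_lebesgue_integral_norm_diff_le A int) (auto simp: set_integrable_def)
    also have "\<dots> \<le> B * V" using V order_trans[OF abs_ge_zero h(2)] by (intro mult_left_mono) auto
    finally show ?thesis by (simp add: G_def set_lebesgue_integral_def)
  qed
  have equi: "\<exists>d>0. \<forall>n y. y \<in> S \<and> norm (x - y) < d \<longrightarrow> norm (G n x - G n y) < e"
    if x: "x \<in> S" and e: "0 < e" for x e
  proof -
    define T where "T = {x - y |x y. x \<in> S \<and> y \<in> S}"
    \<comment> \<open>\<open>V + 1\<close> in place of \<open>V\<close> covers a null set
      \<open>S\<close> and leaves the strict inequality at the end.\<close>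
    have pos: "0 < e / (V + 1)" using e V0 by simp
    have "uniformly_continuous_on T h" unfolding T_def
      using h(1) S(1) compact_differences[OF S(1) S(1)]
      by (intro compact_uniformly_continuous continuous_on_subset[OF h(1)]) auto
    then obtain d where d: "0 < d" "\<And>u v. u \<in> T \<Longrightarrow> v \<in> T \<Longrightarrow> dist v u < d \<Longrightarrow> dist (h v) (h u) < e / (V + 1)"
      unfolding uniformly_continuous_on_def using pos by blast
    show ?thesis
    proof (intro exI[of _ d] conjI allI impI d(1))
      fix n y assume y: "y \<in> S \<and> norm (x - y) < d"
      have "\<bar>(LINT z:A n|lebesgue. h (x - z)) - (LINT z:A n|lebesgue. h (y - z))\<bar> \<le> e / (V + 1) * measure lebesgue (A n)"
      proof (intro set_lebesgue_integral_norm_diff_le A int)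
        fix z assume "z \<in> A n"
        then have "z \<in> S" using S(2) by blast
        then have "dist (h (x - z)) (h (y - z)) < e / (V + 1)"
          using x y by (intro d(2)) (auto simp: dist_norm T_def)
        then show "\<bar>h (x - z) - h (y - z)\<bar> \<le> e / (V + 1)" by (simp add: dist_real_def)
      qed
      also have "\<dots> \<le> e / (V + 1) * V" using e V0 V by (intro mult_left_mono) auto
      also have "\<dots> < e" using e V0 by (simp add: field_simps)
      finally show "norm (G n x - G n y) < e" by (simp add: G_def)
    qed
  qed
  obtain g k where k: "strict_mono (k :: nat \<Rightarrow> nat)"
    and lim: "\<And>e. 0 < e \<Longrightarrow> \<exists>N. \<forall>n x. n \<ge> N \<and> x \<in> S \<longrightarrow> norm (G (k n) x - g x) < e"
    by (rule Arzela_Ascoli[OF S(1), of G "B * V"]) (use bound equi in blast)+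
  obtain N where N: "\<And>n x. n \<ge> N \<Longrightarrow> x \<in> S \<Longrightarrow> norm (G (k n) x - g x) < e / 2"
    using lim[of "e / 2"] e by auto
  show thesis
  proof
    show "strict_mono (\<lambda>i. k (N + i))" using k by (auto simp: strict_mono_def)
    fix i j x assume "x \<in> S"
    then show "\<bar>(LINT y:A (k (N + i))|lebesgue. h (x - y)) - (LINT y:A (k (N + j))|lebesgue. h (x - y))\<bar> \<le> e"
      using N[of "N + i" x] N[of "N + j" x] unfolding G_def[symmetric] real_norm_def by linarith
  qed
qed

section \<open>Radial kernels\<close>

text \<open>This is the fundamental theorem of calculus for \<open>- (u powr (- a))\<close> on
  \<open>{t..1}\<close>. With \<open>t = norm (x - y)\<close> it writes the kernel as a
  superposition of indicators of balls, so that volumes of balls replace polar coordinates.\<close>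

lemma one_over_powr_layer_cake:
  fixes a t :: real
  assumes "0 < a" "0 < t" "t < 1"
  shows "ennreal (1 / t powr a) = 1 + (\<integral>\<^sup>+u. ennreal (a * u powr (- a - 1)) * indicator {t..1} u \<partial>lborel)"
proof -
  have "(\<integral>\<^sup>+u. ennreal (a * u powr (- a - 1)) * indicator {t..1} u \<partial>lborel)
      = - (1 powr (- a)) - - (t powr (- a))"
    using assms
    by (intro nn_integral_FTC_Icc[where F = "\<lambda>u. - (u powr (- a))"])
       (auto intro!: derivative_eq_intros simp: has_real_derivative_iff_has_vector_derivative[symmetric])
  also have "1 + ennreal (- (1 powr (- a)) - - (t powr (- a))) = ennreal (1 / t powr a)"
    using assms powr_mono2'[of "-a" t 1]
    by (subst ennreal_1[symmetric], subst ennreal_plus[symmetric]) (auto simp: powr_minus_divide)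
  finally show ?thesis by simp
qed

text \<open>The layer-cake formula and Tonelli turn the integral into the volume of the annulus plus
  the integral over \<open>u\<close> in \<open>{r..1}\<close> of \<open>a * u powr (- a - 1)\<close>
  times the volume of the shell between radii \<open>r\<close> and \<open>u\<close>.\<close>

lemma nn_integral_kernel_annulus_pos:
  fixes x :: "'a::euclidean_space" and a r :: real
  defines "d \<equiv> real DIM('a)"
  assumes a: "0 < a" "a < d" and r: "0 < r" "r < 1"
  shows "(\<integral>\<^sup>+y. ennreal (1 / norm (x - y) powr a) * indicator (ball x 1 - ball x r) y \<partial>lborel)
    = ennreal (d * unit_ball_vol d * ((1 - r powr (d - a)) / (d - a)))"
proof -
  define w where "w = unit_ball_vol d"
  have w: "w > 0" unfolding w_def d_def by simp
  have d: "d > 0" unfolding d_def by simp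
  \<comment> \<open>A primitive of the one-dimensional integrand that remains after Tonelli.\<close>
  define F where "F u = a * w * (u powr (d - a) / (d - a)) + w * r powr d * u powr (- a)" for u
  have F_deriv: "(F has_real_derivative a * u powr (- a - 1) * (w * (u powr d - r powr d))) (at u within S)"
    if "u \<in> {r..1}" for u S
  proof -
    have e: "u powr (d - a - 1) = u powr (- a - 1) * u powr d"
      using that r by (simp add: powr_add[symmetric] algebra_simps)
    have "((\<lambda>u. u powr (d - a) / (d - a)) has_real_derivative u powr (d - a - 1)) (at u within S)"
      using that r a by (auto intro!: derivative_eq_intros)
    moreover have "((\<lambda>u. u powr (- a)) has_real_derivative - a * u powr (- a - 1)) (at u within S)"
      using that r by (auto intro!: derivative_eq_intros)
    ultimately show ?thesis
      unfolding F_def by (rule DERIV_cong[OF DERIV_add[OF DERIV_cmult DERIV_cmult]]) (simp only: e, algebra)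
  qed
  have F_nonneg: "0 \<le> a * u powr (- a - 1) * (w * (u powr d - r powr d))" if "u \<in> {r..1}" for u
  proof -
    have "r powr d \<le> u powr d" using that r d by (intro powr_mono2) auto
    then show ?thesis using a w by simp
  qed
  have "\<exists>y. (F has_real_derivative y) (at u) \<and> 0 \<le> y" if "r \<le> u" "u \<le> 1" for u
    using F_deriv[of u UNIV] F_nonneg[of u] that by auto
  \<comment> \<open>\<open>ennreal\<close> truncates negative numbers to 0, so the sign of
    \<open>F 1 - F r\<close> has to be known before it is added to the volume.\<close>
  then have F_mono: "F r \<le> F 1"
    using r by (intro DERIV_nonneg_imp_nondecreasing[of r 1 F]) (blast intro: less_imp_le)+
  let ?A = "ball x 1 - ball x r"
  have A [measurable]: "?A \<in> sets borel" by auto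
  have vol: "emeasure lborel (ball x u - ball x r) = ennreal (w * (u powr d - r powr d))"
            "emeasure lborel (cball x u - ball x r) = ennreal (w * (u powr d - r powr d))"
    if "r \<le> u" for u
  proof -
    have *: "u powr d = u ^ DIM('a)" "r powr d = r ^ DIM('a)"
      unfolding d_def using r that by (auto simp: powr_realpow)
    show "emeasure lborel (ball x u - ball x r) = ennreal (w * (u powr d - r powr d))"
      using that r w unfolding *
      by (subst emeasure_Diff) (auto simp: emeasure_ball w_def d_def ennreal_minus right_diff_distrib subset_ball)
    show "emeasure lborel (cball x u - ball x r) = ennreal (w * (u powr d - r powr d))"
      using that r w unfolding *
      by (subst emeasure_Diff) (auto simp: emeasure_ball emeasure_cball w_def d_def ennreal_minus right_diff_distrib intro!: ball_subset_cball[THEN subset_trans])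
  qed
  define f where "f y u = (if r \<le> dist x y \<and> dist x y < 1 \<and> dist x y \<le> u \<and> u \<le> 1
    then ennreal (a * u powr (- a - 1)) else 0)" for y u
  have f [measurable]: "case_prod f \<in> borel_measurable (lborel \<Otimes>\<^sub>M lborel)"
    unfolding f_def by measurable
  have "(\<integral>\<^sup>+y. ennreal (1 / norm (x - y) powr a) * indicator ?A y \<partial>lborel)
      = (\<integral>\<^sup>+y. indicator ?A y + (\<integral>\<^sup>+u. f y u \<partial>lborel) \<partial>lborel)"
  proof (intro nn_integral_cong)
    fix y :: 'a
    show "ennreal (1 / norm (x - y) powr a) * indicator ?A y = indicator ?A y + (\<integral>\<^sup>+u. f y u \<partial>lborel)"
    proof (cases "y \<in> ?A")
      case True
      then have y: "0 < norm (x - y)" "norm (x - y) < 1" using r by (auto simp: dist_norm)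
      have "(\<integral>\<^sup>+u. f y u \<partial>lborel) =
          (\<integral>\<^sup>+u. ennreal (a * u powr (- a - 1)) * indicator {norm (x - y)..1} u \<partial>lborel)"
        using True by (intro nn_integral_cong) (auto simp: f_def dist_norm)
      with True show ?thesis
        by (simp add: one_over_powr_layer_cake[OF a(1) y])
    next
      case False
      then have "f y u = 0" for u by (auto simp: f_def)
      with False show ?thesis by simp
    qed
  qed
  also have "\<dots> = emeasure lborel ?A + (\<integral>\<^sup>+y. (\<integral>\<^sup>+u. f y u \<partial>lborel) \<partial>lborel)"
    by (subst nn_integral_add) (simp_all add: lborel.borel_measurable_nn_integral[OF f, unfolded split_def])
  also have "(\<integral>\<^sup>+y. (\<integral>\<^sup>+u. f y u \<partial>lborel) \<partial>lborel) = (\<integral>\<^sup>+u. (\<integral>\<^sup>+y. f y u \<partial>lborel) \<partial>lborel)"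
    by (rule lborel_pair.Fubini'[OF f, symmetric])
  also have "\<dots> = (\<integral>\<^sup>+u. ennreal (a * u powr (- a - 1) * (w * (u powr d - r powr d))) * indicator {r..1} u \<partial>lborel)"
  proof (intro nn_integral_cong)
    fix u :: real
    \<comment> \<open>The annulus excludes distance 1, so the section in \<open>y\<close> is bounded
      by an open ball when \<open>u = 1\<close> and by a closed one when \<open>u < 1\<close>. Both
      have the same volume.\<close>
    let ?S = "if u = 1 then ball x u - ball x r else cball x u - ball x r"
    show "(\<integral>\<^sup>+y. f y u \<partial>lborel)
       = ennreal (a * u powr (- a - 1) * (w * (u powr d - r powr d))) * indicator {r..1} u"
    proof (cases "u \<in> {r..1}")
      case True
      have "(\<integral>\<^sup>+y. f y u \<partial>lborel) = (\<integral>\<^sup>+y. ennreal (a * u powr (- a - 1)) * indicator ?S y \<partial>lborel)"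
        using True by (intro nn_integral_cong) (auto simp: f_def)
      also have "\<dots> = ennreal (a * u powr (- a - 1)) * emeasure lborel ?S"
        by (rule nn_integral_cmult_indicator) auto
      also have "emeasure lborel ?S = ennreal (w * (u powr d - r powr d))"
        using vol[of u] True by auto
      finally show ?thesis using True a by (simp add: ennreal_mult')
    next
      case False
      then have "f y u = 0" for y by (auto simp: f_def)
      with False show ?thesis by simp
    qed
  qed
  also have "\<dots> = F 1 - F r"
    using F_deriv F_nonneg r by (intro nn_integral_FTC_Icc) (auto simp: has_real_derivative_iff_has_vector_derivative[symmetric])
  also have "emeasure lborel ?A + \<dots> = ennreal (d * w * ((1 - r powr (d - a)) / (d - a)))"
  proof -
    have e: "r powr (d - a) = r powr d * r powr (- a)"
      using r by (simp add: powr_add[symmetric])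
    have le: "r powr (d - a) \<le> 1" "r powr d \<le> 1" using powr_mono2[of "d-a" r 1] powr_mono2[of d r 1] r a d by auto
    \<comment> \<open>The subtracted term is exactly the volume of the annulus, so it cancels
      against \<open>emeasure lborel ?A\<close>.\<close>
    have "F 1 - F r = d * w * ((1 - r powr (d - a)) / (d - a)) - w * (1 - r powr d)"
    proof -
      define R where "R = r powr (d - a)"
      define q where "q = (1 - R) / (d - a)"
      have "q * (d - a) = 1 - R" using a unfolding q_def by simp
      then have "d * w * q = a * w * q + w * (1 - R)" by algebra
      then have "d * w * ((1 - R) / (d - a)) = a * w * ((1 - R) / (d - a)) + w * (1 - R)"
        unfolding q_def .
      then show ?thesis
        unfolding F_def R_def using e by (simp add: diff_divide_distrib algebra_simps)
    qed
    then show ?thesis using r le w F_mono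
      by (simp add: vol ennreal_plus[symmetric] del: ennreal_plus)
  qed
  finally show ?thesis unfolding w_def .
qed

text \<open>The new case \<open>r = 0\<close> is the one for the untruncated functional. It follows
  by monotone convergence as the inner radius decreases to 0; the center causes no trouble because
  the kernel takes the value \<open>1 / 0 = 0\<close> there.\<close>

lemma nn_integral_kernel_annulus:
  fixes x :: "'a::euclidean_space" and a r :: real
  defines "d \<equiv> real DIM('a)"
  assumes a: "0 < a" "a < d" and r: "0 \<le> r" "r < 1"
  shows "(\<integral>\<^sup>+y. ennreal (1 / norm (x - y) powr a) * indicator (ball x 1 - ball x r) y \<partial>lborel)
    = ennreal (d * unit_ball_vol d * ((1 - r powr (d - a)) / (d - a)))"
proof (cases "r = 0")
  case False
  then show ?thesis using nn_integral_kernel_annulus_pos[of a r x] a r unfolding d_def by simp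
next
  case True
  \<comment> \<open>The summand 2 keeps the radius below 1 already for \<open>k = 0\<close>.\<close>
  define \<rho> :: "nat \<Rightarrow> real" where "\<rho> k = 1 / (real k + 2)" for k
  have \<rho>: "0 < \<rho> k" "\<rho> k < 1" for k unfolding \<rho>_def by (auto simp: field_simps)
  have lim0: "\<rho> \<longlonglongrightarrow> 0" unfolding \<rho>_def by real_asymp
  let ?f = "\<lambda>k y. ennreal (1 / norm (x - y) powr a) * indicator (ball x 1 - ball x (\<rho> k)) y"
  have "(\<lambda>k. \<integral>\<^sup>+y. ?f k y \<partial>lborel) \<longlonglongrightarrow>
      (\<integral>\<^sup>+y. ennreal (1 / norm (x - y) powr a) * indicator (ball x 1 - ball x r) y \<partial>lborel)"
  proof (rule nn_integral_LIMSEQ)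
    have "\<rho> (Suc n) \<le> \<rho> n" for n
      unfolding \<rho>_def by (auto intro!: divide_left_mono)
    then have sub: "dist x y < \<rho> n" if "dist x y < \<rho> (Suc n)" for n y
      using that by (meson less_le_trans)
    show "incseq ?f"
    proof (intro incseq_SucI le_funI mult_left_mono)
      fix n y
      show "indicator (ball x 1 - ball x (\<rho> n)) y \<le> (indicator (ball x 1 - ball x (\<rho> (Suc n))) y :: ennreal)"
        using sub[of y n] by (auto simp: indicator_def)
    qed simp
    fix y
    show "(\<lambda>k. ?f k y) \<longlonglongrightarrow> ennreal (1 / norm (x - y) powr a) * indicator (ball x 1 - ball x r) y"
    proof (cases "x = y")
      case False
      then have "eventually (\<lambda>k. \<rho> k < dist x y) sequentially"
        using order_tendstoD(2)[OF lim0] by simp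
      then show ?thesis
        by (intro tendsto_eventually, elim eventually_mono) (auto simp: True indicator_def)
    qed simp
  qed (intro borel_measurable_times_ennreal borel_measurable_indicator, auto)
  moreover have "(\<lambda>k. \<integral>\<^sup>+y. ?f k y \<partial>lborel) =
      (\<lambda>k. ennreal (d * unit_ball_vol d * ((1 - \<rho> k powr (d - a)) / (d - a))))"
    unfolding d_def using a \<rho> by (intro ext nn_integral_kernel_annulus_pos) (auto simp: d_def)
  moreover have "(\<lambda>k. ennreal (d * unit_ball_vol d * ((1 - \<rho> k powr (d - a)) / (d - a)))) \<longlonglongrightarrow>
      ennreal (d * unit_ball_vol d * ((1 - 0) / (d - a)))"
    using a \<rho> by (intro tendsto_intros tendsto_ennrealI tendsto_zero_powrI[OF lim0 tendsto_const])
      (auto simp: less_imp_le)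
  ultimately show ?thesis using True LIMSEQ_unique by simp
qed

section \<open>Measurability on the product space, and truncated kernels of large mass\<close>

lemma sigma_finite_lebesgue: "sigma_finite_measure (lebesgue :: 'a::euclidean_space measure)"
proof -
  obtain A :: "'a set set" where "countable A" "A \<subseteq> sets lborel" "\<Union>A = space lborel"
      "\<forall>a\<in>A. emeasure lborel a \<noteq> \<infinity>"
    using sigma_finite_lborel unfolding sigma_finite_measure_def by blast
  then show ?thesis
    by (intro sigma_finite_measure.intro exI[of _ A]) (auto simp: subset_eq)
qed

interpretation lebesgue: sigma_finite_measure "lebesgue :: 'a::euclidean_space measure"
  by (rule sigma_finite_lebesgue)

interpretation lebesgue_pair: pair_sigma_finite "lebesgue :: 'a::euclidean_space measure"
    "lebesgue :: 'a measure" ..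

lemma measurable_diff_lebesgue [measurable]:
  "(\<lambda>(x, y). x - y) \<in> (lebesgue :: 'a::euclidean_space measure) \<Otimes>\<^sub>M lebesgue \<rightarrow>\<^sub>M borel"
proof -
  have [measurable]: "(\<lambda>x. x) \<in> (lebesgue :: 'a measure) \<rightarrow>\<^sub>M borel"
    by (rule measurable_completion) simp
  show ?thesis by measurable
qed

lemma nn_integral_lborel_reflect:
  fixes h :: "'a::euclidean_space \<Rightarrow> ennreal"
  assumes [measurable]: "h \<in> borel_measurable borel"
  shows "(\<integral>\<^sup>+y. h (x - y) \<partial>lborel) = (\<integral>\<^sup>+z. h z \<partial>lborel)"
  by (subst (2) lborel_affine[of "-1" x]) (simp_all add: nn_integral_density nn_integral_distr)

text \<open>The factor 1/2 leaves room to pass from the exponent \<open>d\<close> to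
  \<open>d + \<sigma>\<close>: for \<open>norm z\<close> at least \<open>\<delta>\<close> the two
  powers differ by a factor \<open>norm z powr (- \<sigma>)\<close>, which exceeds 1/2 once
  \<open>\<sigma>\<close> is close to 0. Evenness makes the interaction of two sets
  symmetric.\<close>

definition admissible_kernel :: "real \<Rightarrow> ('a::euclidean_space \<Rightarrow> real) \<Rightarrow> bool" where
  "admissible_kernel \<delta> h \<longleftrightarrow> 0 < \<delta> \<and> continuous_on UNIV h \<and>
     (\<forall>z. 0 \<le> h z \<and> h (- z) = h z \<and> h z \<le> 1 / norm z powr real DIM('a) / 2 \<and>
        (h z \<noteq> 0 \<longrightarrow> \<delta> \<le> norm z \<and> norm z < 1))"

text \<open>Comparing with \<open>|z|\<^bsup>-d+s\<^esup>\<close> for \<open>s \<rightarrow> 0\<close> gives the divergence. Subtracting \<open>1\<close> makes the kernel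
  vanish continuously at the unit sphere.\<close>

lemma nn_integral_limit_kernel:
  "(\<integral>\<^sup>+z. ennreal (max 0 (1 / norm (z :: 'a::euclidean_space) powr real DIM('a) - 1) / 2) \<partial>lborel) = \<infinity>"
    (is "?I = _")
proof (rule ccontr)
  define d where "d = real DIM('a)"
  define w where "w = unit_ball_vol d"
  have w: "w > 0" unfolding w_def d_def by simp
  have d: "d > 0" unfolding d_def by simp
  assume "?I \<noteq> \<infinity>"
  then obtain I where I: "?I = ennreal I" "0 \<le> I" by (cases ?I) auto
  \<comment> \<open>The left side is the integral of the kernel with exponent \<open>d - s\<close>
    over the unit ball. There this kernel is at most
    \<open>max 0 (1 / norm y powr d - 1) + 1\<close>, and the summand 1 contributes the volume
    \<open>w\<close> of the ball.\<close>
  have *: "d * w / s \<le> 2 * I + w" if s: "0 < s" "s < d" for s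
  proof -
    have "ennreal (d * w * ((1 - 0 powr s) / s)) =
        (\<integral>\<^sup>+y. ennreal (1 / norm (0 - y :: 'a) powr (d - s)) * indicator (ball 0 1 - ball 0 0) y \<partial>lborel)"
      using nn_integral_kernel_annulus[of "d - s" 0 "0::'a"] s unfolding d_def w_def by simp
    also have "\<dots> \<le> (\<integral>\<^sup>+y. 2 * ennreal (max 0 (1 / norm (y :: 'a) powr d - 1) / 2) + indicator (ball 0 1) y \<partial>lborel)"
    proof (intro nn_integral_mono)
      fix y :: 'a
      have "1 / norm y powr (d - s) \<le> max 0 (1 / norm y powr d - 1) + 1" if y: "norm y < 1" "y \<noteq> 0"
      proof -
        have "norm y powr d \<le> norm y powr (d - s)" using y s by (intro powr_mono') auto
        then have "1 / norm y powr (d - s) \<le> 1 / norm y powr d" using y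
          by (intro divide_left_mono) auto
        then show ?thesis by simp
      qed
      moreover have double: "2 * ennreal (max 0 (1 / norm y powr d - 1) / 2) = ennreal (max 0 (1 / norm y powr d - 1))"
        by (simp add: mult_2 ennreal_plus[symmetric] del: ennreal_plus)
      ultimately show "ennreal (1 / norm (0 - y) powr (d - s)) * indicator (ball 0 1 - ball 0 0) y
          \<le> 2 * ennreal (max 0 (1 / norm y powr d - 1) / 2) + indicator (ball 0 1) y"
        using double by (cases "y = 0"; cases "y \<in> ball 0 1") (auto dest!: ennreal_leI simp: ennreal_plus)
    qed
    also have "\<dots> = 2 * ?I + emeasure lborel (ball (0::'a) 1)"
      unfolding d_def by (subst nn_integral_add) (auto simp: nn_integral_cmult intro!: borel_measurable_indicator)
    also have "\<dots> = ennreal (2 * I + w)"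
      using I w by (simp add: emeasure_ball w_def d_def ennreal_mult)
    finally show ?thesis using I w s by (subst (asm) ennreal_le_iff) auto
  qed
  \<comment> \<open>The second entry makes \<open>d * w / s\<close> at least
    \<open>2 * I + 2 * w\<close>, which exceeds the bound \<open>2 * I + w\<close>. The first keeps
    \<open>s < d\<close>.\<close>
  define s where "s = min (d / 2) (d * w / (2 * I + 2 * w))"
  have s: "0 < s" "s < d" "s \<le> d * w / (2 * I + 2 * w)" using w d I unfolding s_def by auto
  then have "2 * I + 2 * w \<le> d * w / s" using I w by (simp add: field_simps)
  with *[OF s(1,2)] w show False by simp
qed

text \<open>The kernel with infinite integral is multiplied by a continuous cutoff that rises from 0
  at radius \<open>1 / (n + 1)\<close> to 1 at radius \<open>2 / (n + 1)\<close>. These products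
  increase to the full kernel away from the origin, so by monotone convergence their masses exceed
  any given \<open>M\<close>.\<close>

lemma admissible_kernel_exists:
  obtains h :: "'a::euclidean_space \<Rightarrow> real" and \<delta>
  where "admissible_kernel \<delta> h" "ennreal M \<le> (\<integral>\<^sup>+z. ennreal (h z) \<partial>lborel)"
proof -
  define d where "d = real DIM('a)"
  have d: "d > 0" unfolding d_def by simp
  \<comment> \<open>The inner \<open>max\<close> keeps the base of the power positive, hence
    \<open>h n\<close> continuous at the origin; wherever the cutoff is nonzero it equals
    \<open>norm z\<close>.\<close>
  define h :: "nat \<Rightarrow> 'a \<Rightarrow> real" where
    "h n z = min 1 (max 0 (real (Suc n) * norm z - 1)) *
       (max 0 (1 / max (norm z) (1 / real (Suc n)) powr d - 1) / 2)" for n z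
  have zero: "h n z = 0" if "norm z \<le> 1 / real (Suc n)" for n z
    using that by (auto simp: h_def field_simps)
  have nonzero: "h n z = min 1 (max 0 (real (Suc n) * norm z - 1)) * (max 0 (1 / norm z powr d - 1) / 2)"
    if "1 / real (Suc n) \<le> norm z" for n z
    using that by (auto simp: h_def max_def)
  have h0: "0 \<le> h n z" for n z unfolding h_def by auto
  have one: "h n z = 0" if "1 \<le> norm z" for n z
  proof -
    have "1 / real (Suc n) \<le> norm z" using that by (auto simp: field_simps intro: order_trans)
    moreover have "1 / norm z powr d \<le> 1"
      using ge_one_powr_ge_zero[of "norm z" d] that d by (simp add: divide_le_eq)
    ultimately show ?thesis by (simp add: nonzero)
  qed
  have adm: "admissible_kernel (1 / real (Suc n)) (h n)" for n
    unfolding admissible_kernel_def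
  proof (intro conjI allI impI)
    have "max (norm z) (1 / real (Suc n)) \<noteq> 0" for z :: 'a
      by (smt (verit) divide_pos_pos of_nat_0_less_iff zero_less_Suc)
    then show "continuous_on UNIV (h n)"
      unfolding h_def by (intro continuous_intros) auto
    fix z
    show "0 \<le> h n z" by (rule h0)
    show "h n (- z) = h n z" by (simp add: h_def)
    show "h n z \<noteq> 0 \<Longrightarrow> 1 / real (Suc n) \<le> norm z" using zero[of z n] by force
    show "h n z \<noteq> 0 \<Longrightarrow> norm z < 1" using one[of z n] by force
    show "h n z \<le> 1 / norm z powr real DIM('a) / 2"
    proof (cases "norm z \<le> 1 / real (Suc n)")
      case False
      then have "h n z \<le> 1 * (max 0 (1 / norm z powr d - 1) / 2)"
        by (subst nonzero) (simp, intro mult_right_mono, auto)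
      also have "\<dots> \<le> 1 / norm z powr d / 2" by auto
      finally show ?thesis by (simp add: d_def)
    qed (simp add: zero)
  qed simp
  have "(\<lambda>n. \<integral>\<^sup>+z. ennreal (h n z) \<partial>lborel) \<longlonglongrightarrow>
      (\<integral>\<^sup>+z. ennreal (max 0 (1 / norm (z :: 'a) powr d - 1) / 2) \<partial>lborel)"
  proof (rule nn_integral_LIMSEQ)
    have "h m z \<le> h n z" if "m \<le> n" for m n z
    proof (cases "norm z \<le> 1 / real (Suc m)")
      case False
      then have m: "1 / real (Suc m) \<le> norm z" by simp
      have "1 / real (Suc n) \<le> 1 / real (Suc m)" using that by (intro divide_left_mono) auto
      with m have n: "1 / real (Suc n) \<le> norm z" by (rule order_trans[rotated])
      have "real (Suc m) * norm z \<le> real (Suc n) * norm z" using that by (intro mult_right_mono) auto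
      then show ?thesis
        unfolding nonzero[OF m] nonzero[OF n] by (intro mult_right_mono min.mono max.mono) auto
    qed (simp add: zero h0)
    then show "incseq (\<lambda>n z. ennreal (h n z))"
      by (auto simp: incseq_def le_fun_def intro!: ennreal_leI)
    show "(\<lambda>z. ennreal (h n z)) \<in> borel_measurable lborel" for n
      using adm[of n] by (auto simp: admissible_kernel_def intro!: borel_measurable_continuous_onI)
    fix z :: 'a
    show "(\<lambda>n. ennreal (h n z)) \<longlonglongrightarrow> ennreal (max 0 (1 / norm z powr d - 1) / 2)"
    proof (cases "z = 0")
      case False
      have "filterlim (\<lambda>n. real (Suc n) * norm z) at_top sequentially"
        using False by real_asymp
      then have "eventually (\<lambda>n. 2 \<le> real (Suc n) * norm z) sequentially"
        by (auto simp: filterlim_at_top)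
      then have "eventually (\<lambda>n. h n z = max 0 (1 / norm z powr d - 1) / 2) sequentially"
        by eventually_elim (subst nonzero, auto simp: field_simps)
      then show ?thesis
        by (intro tendsto_eventually) (auto elim: eventually_mono)
    qed (simp add: zero)
  qed
  then have "(\<lambda>n. \<integral>\<^sup>+z. ennreal (h n z) \<partial>lborel) \<longlonglongrightarrow> \<infinity>"
    by (simp add: nn_integral_limit_kernel d_def)
  then have "eventually (\<lambda>n. ennreal M < (\<integral>\<^sup>+z. ennreal (h n z) \<partial>lborel)) sequentially"
    by (rule order_tendstoD(1)) simp
  then obtain n where "ennreal M < (\<integral>\<^sup>+z. ennreal (h n z) \<partial>lborel)"
    by (auto simp: eventually_sequentially)
  then show thesis using adm that less_imp_le by blast
qed

section \<open>The nonlocal interaction\<close>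

text \<open>Values in \<open>ennreal\<close> allow Tonelli without integrability conditions, also
  when one of the sets is a complement of infinite measure.\<close>

definition interaction :: "('a::euclidean_space \<Rightarrow> real) \<Rightarrow> 'a set \<Rightarrow> 'a set \<Rightarrow> ennreal" where
  "interaction h A B =
     (\<integral>\<^sup>+x. \<integral>\<^sup>+y. indicator A x * (indicator B y * ennreal (h (x - y))) \<partial>lebesgue \<partial>lebesgue)"

lemma measurable_kernel_product:
  fixes A B :: "'a::euclidean_space set"
  assumes [measurable]: "h \<in> borel_measurable borel" "A \<in> sets lebesgue" "B \<in> sets lebesgue"
  shows "(\<lambda>(x, y). indicator A x * (indicator B y * ennreal (h (x - y)))) \<in> borel_measurable (lebesgue \<Otimes>\<^sub>M lebesgue)"
proof -
  have [measurable]: "(\<lambda>p. h (fst p - snd p)) \<in> borel_measurable ((lebesgue :: 'a measure) \<Otimes>\<^sub>M lebesgue)"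
    using measurable_compose[OF measurable_diff_lebesgue assms(1)] by (simp add: split_def)
  show ?thesis unfolding split_def by measurable
qed

lemma interaction_commute:
  assumes h: "h \<in> borel_measurable borel" "\<And>z. h (- z) = h z"
    and A: "A \<in> sets lebesgue" and B: "B \<in> sets lebesgue"
  shows "interaction h A B = interaction h B A"
proof -
  have sym: "h (x - y) = h (y - x)" for x y using h(2)[of "y - x"] by simp
  have "interaction h A B = (\<integral>\<^sup>+y. \<integral>\<^sup>+x. indicator A x * (indicator B y * ennreal (h (x - y))) \<partial>lebesgue \<partial>lebesgue)"
    unfolding interaction_def by (rule lebesgue_pair.Fubini'[OF measurable_kernel_product[OF h(1) A B], symmetric])
  also have "\<dots> = interaction h B A"
    unfolding interaction_def
    by (intro nn_integral_cong) (subst sym, simp add: mult.left_commute)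
  finally show ?thesis .
qed

lemma admissible_kernel_measurable:
  "admissible_kernel \<delta> h \<Longrightarrow> h \<in> borel_measurable borel"
  unfolding admissible_kernel_def by (blast intro: borel_measurable_continuous_onI)

lemma admissible_kernel_bound:
  fixes h :: "'a::euclidean_space \<Rightarrow> real"
  assumes h: "admissible_kernel \<delta> h"
  shows "\<bar>h z\<bar> \<le> 1 / \<delta> powr real DIM('a)"
proof (cases "h z = 0")
  case False
  have h': "0 < \<delta>" "0 \<le> h z" "h z \<le> 1 / norm z powr real DIM('a) / 2" "\<delta> \<le> norm z"
    using h False unfolding admissible_kernel_def by auto
  have "1 / norm z powr real DIM('a) / 2 \<le> 1 / norm z powr real DIM('a)"
    using powr_ge_zero[of "norm z" "real DIM('a)"] by (simp add: field_split_simps)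
  also have "\<dots> \<le> 1 / \<delta> powr real DIM('a)"
    using h' by (intro divide_left_mono powr_mono2 mult_pos_pos) auto
  finally show ?thesis using h' by simp
qed simp

text \<open>Let \<open>x\<close> be in \<open>A\<close> but not in \<open>B\<close>. The mass of
  \<open>h\<close> around \<open>x\<close> splits into the part seen in \<open>A\<close> and the
  part seen in \<open>- A\<close>; by \<open>close\<close> the former is at most the part seen in
  \<open>B\<close>, plus 1. So \<open>M\<close> is at most 1 plus the interaction of
  \<open>x\<close> with \<open>- A\<close> and with \<open>B\<close>, and \<open>x\<close> lies on
  the opposite side of both sets. Integrating this and its mirror image gives the measure of
  \<open>S\<close> from the 1, and two interactions for each of \<open>A\<close> and
  \<open>B\<close>, that is \<open>4 * c\<close>.\<close>

lemma measure_sym_diff_le_interaction: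
  fixes h :: "'a::euclidean_space \<Rightarrow> real" and A B S :: "'a set"
  assumes h: "admissible_kernel \<delta> h" and M: "ennreal M \<le> (\<integral>\<^sup>+z. ennreal (h z) \<partial>lborel)" "0 \<le> M"
    and A: "A \<in> lmeasurable" "A \<subseteq> S" and B: "B \<in> lmeasurable" "B \<subseteq> S" and S: "S \<in> lmeasurable"
    and close: "\<And>x. x \<in> S \<Longrightarrow> \<bar>(LINT y:A|lebesgue. h (x - y)) - (LINT y:B|lebesgue. h (x - y))\<bar> \<le> 1"
    and energy: "interaction h A (- A) \<le> ennreal c" "interaction h B (- B) \<le> ennreal c" "0 \<le> c"
  shows "M * measure lebesgue (sym_diff A B) \<le> measure lebesgue S + 4 * c"
proof -
  note hm = admissible_kernel_measurable[OF h]
  have h0: "\<And>z. 0 \<le> h z" "\<And>z. h (- z) = h z" and hc: "continuous_on UNIV h"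
    using h unfolding admissible_kernel_def by auto
  define Q where "Q C x = (\<integral>\<^sup>+y. indicator C y * ennreal (h (x - y)) \<partial>lebesgue)" for C :: "'a set" and x
  have meas [measurable]: "A \<in> sets lebesgue" "B \<in> sets lebesgue" "S \<in> sets lebesgue"
    using A B S by auto
  have hx [measurable]: "(\<lambda>y. h (x - y)) \<in> borel_measurable lebesgue" for x
    using measurable_completion[of "\<lambda>y. h (x - y)" lborel borel] hm by simp
  have Qm [measurable]: "Q C \<in> borel_measurable lebesgue" if "C \<in> sets lebesgue" for C
    using lebesgue.borel_measurable_nn_integral[OF measurable_kernel_product[OF hm _ that, of UNIV]]
    unfolding Q_def by simp
  have Q_int: "Q C x = ennreal (LINT y:C|lebesgue. h (x - y))" if "C \<in> lmeasurable" for C x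
  proof -
    have "set_integrable lebesgue C (\<lambda>y. h (x - y))"
      by (rule convolution_integrable[OF hc admissible_kernel_bound[OF h] that])
    then show ?thesis
      unfolding Q_def set_lebesgue_integral_def set_integrable_def
      by (subst nn_integral_eq_integral[symmetric])
        (use h0 in \<open>auto simp: ennreal_mult' ennreal_indicator intro!: nn_integral_cong\<close>)
  qed
  have total: "ennreal M \<le> Q C x + Q (- C) x" if [measurable]: "C \<in> sets lebesgue" for C x
  proof -
    have "ennreal M \<le> (\<integral>\<^sup>+y. ennreal (h (x - y)) \<partial>lborel)"
      using M by (subst nn_integral_lborel_reflect[where h = "\<lambda>z. ennreal (h z)"]) (use hm in auto)
    also have "\<dots> = (\<integral>\<^sup>+y. indicator C y * ennreal (h (x - y)) + indicator (- C) y * ennreal (h (x - y)) \<partial>lebesgue)"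
      unfolding nn_integral_completion by (intro nn_integral_cong) (auto simp: indicator_def)
    also have "\<dots> = Q C x + Q (- C) x"
      unfolding Q_def by (subst nn_integral_add) auto
    finally show ?thesis .
  qed
  have swap: "Q C x \<le> Q D x + 1" if "x \<in> S" "(C, D) = (A, B) \<or> (C, D) = (B, A)" for x C D
  proof -
    have lm: "C \<in> lmeasurable" "D \<in> lmeasurable" using that(2) A B by auto
    have "0 \<le> (LINT y:D|lebesgue. h (x - y))"
      unfolding set_lebesgue_integral_def using h0(1) by (intro integral_nonneg_AE AE_I2) simp
    then have "ennreal ((LINT y:D|lebesgue. h (x - y)) + 1) = Q D x + 1"
      unfolding Q_int[OF lm(2)] by (subst ennreal_plus) simp_all
    moreover have "(LINT y:C|lebesgue. h (x - y)) \<le> (LINT y:D|lebesgue. h (x - y)) + 1"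
      using close[OF that(1)] that(2) by (auto simp: abs_le_iff)
    ultimately show ?thesis
      unfolding Q_int[OF lm(1)] by (metis ennreal_leI)
  qed
  have pointwise: "ennreal M * indicator (sym_diff A B) x \<le> indicator S x +
      ((indicator A x * Q (- A) x + indicator (- A) x * Q A x) + (indicator B x * Q (- B) x + indicator (- B) x * Q B x))" for x
  proof -
    consider "x \<in> A" "x \<notin> B" | "x \<in> B" "x \<notin> A" | "x \<notin> sym_diff A B" by blast
    then show ?thesis
    proof cases
      case 1
      have "ennreal M \<le> Q A x + Q (- A) x" by (rule total) simp
      also have "\<dots> \<le> (Q B x + 1) + Q (- A) x" using 1 A by (intro add_right_mono swap) auto
      finally show ?thesis using 1 A by (auto simp: ac_simps)
    next
      case 2
      have "ennreal M \<le> Q B x + Q (- B) x" by (rule total) simp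
      also have "\<dots> \<le> (Q A x + 1) + Q (- B) x" using 2 B by (intro add_right_mono swap) auto
      finally show ?thesis using 2 B by (auto simp: ac_simps)
    qed simp
  qed
  have Q_energy: "(\<integral>\<^sup>+x. indicator C x * Q D x \<partial>lebesgue) = interaction h C D" if "D \<in> sets lebesgue" for C D
    unfolding interaction_def Q_def using that by (subst nn_integral_cmult[symmetric]) auto
  have compl: "- C \<in> sets lebesgue" if "C \<in> sets lebesgue" for C :: "'a set"
    using sets.compl_sets[OF that] by (simp add: Compl_eq_Diff_UNIV)
  have QIm: "(\<lambda>x. indicator C x * Q D x) \<in> borel_measurable lebesgue"
    if "C \<in> sets lebesgue" "D \<in> sets lebesgue" for C D
    by (intro borel_measurable_times_ennreal borel_measurable_indicator Qm that)
  \<comment> \<open>By evenness of \<open>h\<close> the interaction of the complement with the set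
    equals that of the set with its complement, whence the factor 2.\<close>
  have both: "(\<integral>\<^sup>+x. indicator C x * Q (- C) x + indicator (- C) x * Q C x \<partial>lebesgue) \<le> ennreal (2 * c)"
    if C [measurable]: "C \<in> sets lebesgue" and le: "interaction h C (- C) \<le> ennreal c" for C
  proof -
    have "(\<integral>\<^sup>+x. indicator C x * Q (- C) x + indicator (- C) x * Q C x \<partial>lebesgue) =
        interaction h C (- C) + interaction h (- C) C"
      by (subst nn_integral_add) (simp_all add: QIm Q_energy C compl)
    also have "\<dots> = interaction h C (- C) + interaction h C (- C)"
      using interaction_commute[OF hm h0(2) C compl[OF C]] by simp
    also have "\<dots> \<le> ennreal c + ennreal c" using le by (intro add_mono)
    finally show ?thesis using energy(3) by (simp add: ennreal_plus[symmetric] del: ennreal_plus)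
  qed
  have "ennreal (M * measure lebesgue (sym_diff A B)) = ennreal M * emeasure lebesgue (sym_diff A B)"
    using M A B by (subst emeasure_eq_measure2) (auto simp: ennreal_mult)
  also have "\<dots> = (\<integral>\<^sup>+x. ennreal M * indicator (sym_diff A B) x \<partial>lebesgue)"
    by (rule nn_integral_cmult_indicator[symmetric]) auto
  also have "\<dots> \<le> (\<integral>\<^sup>+x. indicator S x +
      ((indicator A x * Q (- A) x + indicator (- A) x * Q A x) + (indicator B x * Q (- B) x + indicator (- B) x * Q B x)) \<partial>lebesgue)"
    by (intro nn_integral_mono pointwise)
  also have "\<dots> = emeasure lebesgue S +
      ((\<integral>\<^sup>+x. indicator A x * Q (- A) x + indicator (- A) x * Q A x \<partial>lebesgue) +
       (\<integral>\<^sup>+x. indicator B x * Q (- B) x + indicator (- B) x * Q B x \<partial>lebesgue))"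
    by (simp only: nn_integral_add borel_measurable_add QIm compl meas borel_measurable_indicator)
      (simp add: nn_integral_add QIm compl)
  also have "\<dots> \<le> ennreal (measure lebesgue S) + (ennreal (2 * c) + ennreal (2 * c))"
    using S energy by (intro add_mono both) (auto simp: emeasure_eq_measure2)
  also have "\<dots> = ennreal (measure lebesgue S + 4 * c)"
    using energy(3) by (simp add: ennreal_plus[symmetric] del: ennreal_plus)
  finally show ?thesis using energy(3) by (subst (asm) ennreal_le_iff) auto
qed

section \<open>Compactness\<close>

text \<open>Around each \<open>x\<close>, apply the truncated kernel \<open>k\<close> on
  \<open>E\<close> and the smaller \<open>h\<close> on the complement. Within distance 1 the sum is
  at most \<open>k\<close>, whose integral there is \<open>g\<close>, the negative of the
  coefficient in the functional. Farther out \<open>h\<close> vanishes and \<open>k\<close> is at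
  most 1, so only \<open>E\<close> contributes, at most its measure \<open>m\<close>. Integrating
  over \<open>E\<close> bounds the self-interaction \<open>N\<close> plus the interaction with the
  complement by \<open>(g + m) * m\<close>, while the functional equals
  \<open>g * m - N\<close>.\<close>

lemma interaction_le_J_hat_core:
  fixes E :: "'a::euclidean_space set"
  assumes E: "E \<in> lmeasurable" and \<sigma>: "- real DIM('a) < \<sigma>" "\<sigma> < 0" and r: "0 \<le> r" "r < 1"
    and h: "admissible_kernel \<delta> h"
    and dom: "\<And>z. h z \<le> (if norm z < r then 0 else 1 / norm z powr (real DIM('a) + \<sigma>))"
  shows "interaction h E (- E) \<le> ennreal (J_hat_core \<sigma> r E + (measure lebesgue E)\<^sup>2)"
proof -
  define a where "a = real DIM('a) + \<sigma>"
  define k :: "'a \<Rightarrow> real" where "k z = (if norm z < r then 0 else 1 / norm z powr a)" for z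
  define g where "g = - gamma_coeff DIM('a) \<sigma> r"
  define m where "m = measure lebesgue E"
  have a: "0 < a" "a < real DIM('a)" using \<sigma> by (auto simp: a_def)
  have k0: "0 \<le> k z" for z by (simp add: k_def)
  have hk: "h z \<le> k z" for z using dom[of z] unfolding k_def a_def .
  have km [measurable]: "k \<in> borel_measurable borel" unfolding k_def by measurable
  note hm [measurable] = admissible_kernel_measurable[OF h]
  have h1: "h z \<noteq> 0 \<Longrightarrow> norm z < 1" for z using h by (auto simp: admissible_kernel_def)
  have E' [measurable]: "E \<in> sets lebesgue" using E by auto
  have emE: "emeasure lebesgue E = ennreal m" using E by (simp add: m_def emeasure_eq_measure2)
  have m0: "0 \<le> m" by (simp add: m_def)
  have "r powr (- \<sigma>) \<le> 1" using powr_mono2[of "- \<sigma>" r 1] r \<sigma> by auto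
  then have g0: "0 \<le> g" using \<sigma> by (auto simp: g_def gamma_coeff_def mult_le_0_iff divide_le_0_iff mult_nonneg_nonpos divide_nonneg_neg)
  have kx [measurable]: "(\<lambda>y. k (x - y)) \<in> borel_measurable lebesgue" for x
    using measurable_completion[of "\<lambda>y. k (x - y)" lborel borel] km by simp
  have hx [measurable]: "(\<lambda>y. h (x - y)) \<in> borel_measurable lebesgue" for x
    using measurable_completion[of "\<lambda>y. h (x - y)" lborel borel] hm by simp
  define I where "I x = (\<integral>\<^sup>+y. indicator E y * ennreal (k (x - y)) \<partial>lebesgue)" for x
  define P where "P x = (\<integral>\<^sup>+y. indicator (- E) y * ennreal (h (x - y)) \<partial>lebesgue)" for x
  have Im [measurable]: "I \<in> borel_measurable lebesgue"
    using lebesgue.borel_measurable_nn_integral[OF measurable_kernel_product[of k UNIV E]]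
    unfolding I_def by simp
  have Pm [measurable]: "P \<in> borel_measurable lebesgue"
    using lebesgue.borel_measurable_nn_integral[OF measurable_kernel_product[of h UNIV "- E"]]
    unfolding P_def by simp
  have IP: "I x + P x \<le> ennreal (g + m)" for x
  proof -
    have "I x + P x = (\<integral>\<^sup>+y. indicator E y * ennreal (k (x - y)) + indicator (- E) y * ennreal (h (x - y)) \<partial>lebesgue)"
      unfolding I_def P_def by (subst nn_integral_add) auto
    also have "\<dots> \<le> (\<integral>\<^sup>+y. ennreal (1 / norm (x - y) powr a) * indicator (ball x 1 - ball x r) y + indicator E y \<partial>lebesgue)"
    proof (intro nn_integral_mono)
      fix y
      have far: "k (x - y) \<le> 1" if "1 \<le> norm (x - y)"
        using that a ge_one_powr_ge_zero[of "norm (x - y)" a] by (auto simp: k_def divide_le_eq)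
      have near: "ennreal (k (x - y)) \<le> ennreal (1 / norm (x - y) powr a) * indicator (ball x 1 - ball x r) y"
        if "norm (x - y) < 1"
        using that by (auto simp: k_def dist_norm indicator_def)
      show "indicator E y * ennreal (k (x - y)) + indicator (- E) y * ennreal (h (x - y))
        \<le> ennreal (1 / norm (x - y) powr a) * indicator (ball x 1 - ball x r) y + indicator E y"
      proof (cases "y \<in> E")
        case True
        show ?thesis
        proof (cases "norm (x - y) < 1")
          case False
          then have "ennreal (k (x - y)) \<le> 1" using far by (simp flip: ennreal_1)
          then show ?thesis using True by (simp add: add_increasing)
        qed (use near True in \<open>simp add: add_increasing2\<close>)
      next
        case False
        have "ennreal (h (x - y)) \<le> ennreal (1 / norm (x - y) powr a) * indicator (ball x 1 - ball x r) y"
        proof (cases "h (x - y) = 0")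
          case False
          have "ennreal (h (x - y)) \<le> ennreal (k (x - y))" using hk by (rule ennreal_leI)
          also note near[OF h1[OF False]]
          finally show ?thesis .
        qed simp
        with False show ?thesis by simp
      qed
    qed
    also have "\<dots> = (\<integral>\<^sup>+y. ennreal (1 / norm (x - y) powr a) * indicator (ball x 1 - ball x r) y \<partial>lborel) + emeasure lebesgue E"
    proof -
      have "(\<lambda>y. ennreal (1 / norm (x - y) powr a) * indicator (ball x 1 - ball x r) y) \<in> borel_measurable lborel"
        by (intro borel_measurable_times_ennreal borel_measurable_indicator) auto
      note add = nn_integral_add[OF measurable_completion[OF this], of "indicator E"]
      show ?thesis
        by (subst add) (simp_all only: nn_integral_indicator[OF E'] borel_measurable_indicator E', simp only: nn_integral_completion)
    qed
    also have "\<dots> = ennreal (real DIM('a) * unit_ball_vol (real DIM('a)) * ((1 - r powr (real DIM('a) - a)) / (real DIM('a) - a))) + ennreal m"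
      by (simp only: nn_integral_kernel_annulus[OF a r] emE)
    also have "\<dots> = ennreal g + ennreal m"
      by (simp add: g_def gamma_coeff_def a_def)
    finally show ?thesis using g0 m0 by simp
  qed
  \<comment> \<open>Finiteness is essential here, as \<open>enn2real\<close> sends infinity to 0. It
    links the Bochner integrals of the functional to the nonnegative integrals used for the
    estimate.\<close>
  have I_fin: "ennreal (enn2real (I x)) = I x" for x
  proof -
    have "I x \<le> ennreal (g + m)" using IP[of x] by (meson add_increasing2 order_trans zero_le le_iff_add)
    then have "I x < top" using ennreal_less_top by (rule order.strict_trans1)
    then show ?thesis by simp
  qed
  define N where "N = (\<integral>\<^sup>+x. indicator E x * I x \<partial>lebesgue)"
  have D: "interaction h E (- E) = (\<integral>\<^sup>+x. indicator E x * P x \<partial>lebesgue)"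
    unfolding interaction_def P_def by (subst nn_integral_cmult[symmetric]) auto
  have ND: "N + interaction h E (- E) \<le> ennreal ((g + m) * m)"
  proof -
    have "N + interaction h E (- E) = (\<integral>\<^sup>+x. indicator E x * I x + indicator E x * P x \<partial>lebesgue)"
      unfolding N_def D by (subst nn_integral_add) auto
    also have "\<dots> \<le> (\<integral>\<^sup>+x. ennreal (g + m) * indicator E x \<partial>lebesgue)"
      using IP by (intro nn_integral_mono) (auto simp: indicator_def)
    also have "\<dots> = ennreal ((g + m) * m)"
      using g0 m0 by (simp add: nn_integral_cmult_indicator emE ennreal_mult)
    finally show ?thesis .
  qed
  have "(LINT y:(E - ball x r)|lebesgue. 1 / norm (x - y) powr (real DIM('a) + \<sigma>)) = enn2real (I x)" for x
  proof -
    have "(LINT y:(E - ball x r)|lebesgue. 1 / norm (x - y) powr (real DIM('a) + \<sigma>)) =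
        (LINT y|lebesgue. indicator E y * k (x - y))"
      unfolding set_lebesgue_integral_def
      by (intro Bochner_Integration.integral_cong) (auto simp: indicator_def k_def a_def dist_norm)
    also have "\<dots> = enn2real (\<integral>\<^sup>+y. ennreal (indicator E y * k (x - y)) \<partial>lebesgue)"
      using k0 by (intro integral_eq_nn_integral) auto
    also have "(\<integral>\<^sup>+y. ennreal (indicator E y * k (x - y)) \<partial>lebesgue) = I x"
      unfolding I_def by (intro nn_integral_cong) (auto simp: indicator_def)
    finally show ?thesis .
  qed
  then have "J_hat_core \<sigma> r E = - (LINT x:E|lebesgue. enn2real (I x)) + g * m"
    by (simp add: J_hat_core_def g_def m_def)
  also have "(LINT x:E|lebesgue. enn2real (I x)) = enn2real (\<integral>\<^sup>+x. ennreal (indicator E x * enn2real (I x)) \<partial>lebesgue)"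
    unfolding set_lebesgue_integral_def by (subst integral_eq_nn_integral) auto
  also have "(\<integral>\<^sup>+x. ennreal (indicator E x * enn2real (I x)) \<partial>lebesgue) = N"
    unfolding N_def by (intro nn_integral_cong) (auto simp: indicator_def I_fin)
  finally have J: "J_hat_core \<sigma> r E = - enn2real N + g * m" .
  have fin: "N < top" "interaction h E (- E) < top"
    using order.strict_trans1[OF ND ennreal_less_top] by auto
  then obtain n i where ni: "N = ennreal n" "0 \<le> n" "interaction h E (- E) = ennreal i" "0 \<le> i"
    by (metis enn2real_nonneg ennreal_enn2real)
  have "n + i \<le> (g + m) * m"
    using ND ni g0 m0 by (simp add: ennreal_plus[symmetric] del: ennreal_plus)
  then show ?thesis
    unfolding ni J m_def[symmetric] using ni by (auto intro!: ennreal_leI simp: power2_eq_square algebra_simps)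
qed

text \<open>Since \<open>c\<close> is independent of the kernel, a kernel of large mass makes the
  bound of \<open>measure_sym_diff_le_interaction\<close> small, once the convolutions with this
  kernel are within 1 of each other. This yields total boundedness. The index after which the energy
  bound holds may depend on the kernel, which explains the shift by \<open>N\<close>.\<close>

lemma interaction_bounded_imp_convergent_subseq:
  fixes A :: "nat \<Rightarrow> 'a::euclidean_space set"
  assumes A: "\<And>n. A n \<in> lmeasurable" "\<And>n. A n \<subseteq> S" and S: "compact S" and c: "0 \<le> c"
    and energy: "\<And>\<delta> h. admissible_kernel \<delta> h \<Longrightarrow>
      eventually (\<lambda>n. interaction h (A n) (- A n) \<le> ennreal c) sequentially"
  obtains \<phi> F where "strict_mono (\<phi> :: nat \<Rightarrow> nat)" "F \<in> lmeasurable"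
    "(\<lambda>k. LINT x|lebesgue. \<bar>indicat_real (A (\<phi> k)) x - indicat_real F x\<bar>) \<longlonglongrightarrow> 0"
proof (rule fmeasurable_totally_bounded_imp_convergent_subseq[of A lebesgue S])
  show Sm: "S \<in> lmeasurable" using S by (rule lmeasurable_compact)
  fix e :: real and s :: "nat \<Rightarrow> nat" assume e: "0 < e" and s: "strict_mono s"
  define V where "V = measure lebesgue S"
  \<comment> \<open>Chosen so that \<open>M * e = V + 4 * c\<close>. The kernel is given mass
    \<open>M + 1\<close> because \<open>M\<close> itself may be 0 and the final step divides by the
    mass.\<close>
  define M where "M = (V + 4 * c) / e"
  have M: "0 \<le> M" using e c by (simp add: M_def V_def)
  obtain h :: "'a \<Rightarrow> real" and \<delta> where h: "admissible_kernel \<delta> h"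
    and big: "ennreal (M + 1) \<le> (\<integral>\<^sup>+z. ennreal (h z) \<partial>lborel)"
    by (rule admissible_kernel_exists)
  obtain N where N: "\<And>n. N \<le> n \<Longrightarrow> interaction h (A n) (- A n) \<le> ennreal c"
    using energy[OF h] by (auto simp: eventually_sequentially)
  have hc: "continuous_on UNIV h" using h by (simp add: admissible_kernel_def)
  obtain k :: "nat \<Rightarrow> nat" where k: "strict_mono k"
    and close: "\<And>i j x. x \<in> S \<Longrightarrow>
      \<bar>(LINT y:A (s (N + k i))|lebesgue. h (x - y)) - (LINT y:A (s (N + k j))|lebesgue. h (x - y))\<bar> \<le> 1"
    using convolution_convergent_subseq[OF hc admissible_kernel_bound[OF h], of "\<lambda>n. A (s (N + n))" S 1]
      A S by (metis zero_less_one)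
  have "measure lebesgue (sym_diff (A (s (N + k i))) (A (s (N + k j)))) \<le> e" for i j
  proof -
    have N': "N \<le> s (N + n)" for n using seq_suble[OF s, of "N + n"] by simp
    have "(M + 1) * measure lebesgue (sym_diff (A (s (N + k i))) (A (s (N + k j)))) \<le> V + 4 * c"
      unfolding V_def using M
      by (intro measure_sym_diff_le_interaction[OF h big _ A A Sm] close N N' c) auto
    also have "V + 4 * c = M * e" using e by (simp add: M_def)
    also have "\<dots> \<le> (M + 1) * e" using e by simp
    finally show ?thesis using M by simp
  qed
  then show "\<exists>r. strict_mono (r :: nat \<Rightarrow> nat) \<and>
      (\<forall>i j. measure lebesgue (sym_diff (A (s (r i))) (A (s (r j)))) \<le> e)"
    using k by (intro exI[of _ "\<lambda>i. N + k i"]) (auto simp: strict_mono_def)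
qed (use A that in auto)

text \<open>For a fixed kernel the domination required by \<open>interaction_le_J_hat_core\<close>
  holds for all large \<open>n\<close>, and the resulting constant involves only \<open>C\<close>
  and the measure of the closure of \<open>U\<close>. Allowing \<open>r n = 0\<close> lets both
  functionals be treated at once.\<close>

lemma J_hat_core_bounded_imp_convergent_subseq:
  fixes \<sigma> r :: "nat \<Rightarrow> real" and U :: "'a::euclidean_space set" and E :: "nat \<Rightarrow> 'a set"
  assumes \<sigma>: "\<And>n. - real DIM('a) < \<sigma> n" "\<And>n. \<sigma> n < 0" "\<sigma> \<longlonglongrightarrow> 0"
    and r: "\<And>n. 0 \<le> r n" "r \<longlonglongrightarrow> 0"
    and U: "bounded U" and E: "\<And>n. E n \<in> lmeasurable" "\<And>n. E n \<subseteq> U"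
    and J: "\<And>n. J_hat_core (\<sigma> n) (r n) (E n) \<le> C"
  shows "\<exists>\<phi> F. strict_mono (\<phi> :: nat \<Rightarrow> nat) \<and> F \<in> lmeasurable \<and>
    (\<lambda>k. LINT x|lebesgue. \<bar>indicat_real (E (\<phi> k)) x - indicat_real F x\<bar>) \<longlonglongrightarrow> 0"
proof -
  define V where "V = measure lebesgue (closure U)"
  have S: "compact (closure U)" using U by simp
  have ES: "E n \<subseteq> closure U" for n using E(2) closure_subset by blast
  have V: "measure lebesgue (E n) \<le> V" for n
    unfolding V_def using E(1) ES lmeasurable_compact[OF S]
    by (intro measure_mono_fmeasurable) auto
  have energy: "eventually (\<lambda>n. interaction h (E n) (- E n) \<le> ennreal (max 0 (C + V\<^sup>2))) sequentially"
    if h: "admissible_kernel \<delta> h" for \<delta> h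
  proof -
    have \<delta>: "0 < \<delta>" using h by (simp add: admissible_kernel_def)
    have "(\<lambda>n. \<delta> powr (- \<sigma> n)) \<longlonglongrightarrow> \<delta> powr (- 0)"
      using \<delta> by (intro tendsto_intros \<sigma>(3)) auto
    \<comment> \<open>This absorbs the factor 1/2 of an admissible kernel: on its support
      \<open>norm z powr (- \<sigma> n)\<close> is at least
      \<open>\<delta> powr (- \<sigma> n)\<close>.\<close>
    then have "eventually (\<lambda>n. 1 / 2 < \<delta> powr (- \<sigma> n)) sequentially"
      by (rule order_tendstoD(1)) (use \<delta> in simp)
    \<comment> \<open>Below \<open>\<delta>\<close> the truncation does not meet the support of
      \<open>h\<close>; below 1 the annulus formula applies.\<close>
    moreover have "eventually (\<lambda>n. r n < min \<delta> 1) sequentially"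
      by (rule order_tendstoD(2)[OF r(2)]) (use \<delta> in simp)
    ultimately show ?thesis
    proof eventually_elim
      case (elim n)
      have "h z \<le> (if norm z < r n then 0 else 1 / norm z powr (real DIM('a) + \<sigma> n))" for z
      proof (cases "h z = 0")
        case False
        then have z: "\<delta> \<le> norm z" "h z \<le> 1 / norm z powr real DIM('a) / 2"
          using h by (auto simp: admissible_kernel_def)
        have "\<delta> powr (- \<sigma> n) \<le> norm z powr (- \<sigma> n)"
          using z \<delta> \<sigma>(2)[of n] by (intro powr_mono2) auto
        with elim have "1 / 2 \<le> norm z powr (- \<sigma> n)" by simp
        then have "1 / norm z powr real DIM('a) * (1 / 2) \<le> 1 / norm z powr real DIM('a) * norm z powr (- \<sigma> n)"
          by (intro mult_left_mono) auto
        also have "\<dots> = 1 / norm z powr (real DIM('a) + \<sigma> n)"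
          by (simp add: powr_add powr_minus field_simps)
        finally show ?thesis using z elim by auto
      qed simp
      then have "interaction h (E n) (- E n) \<le> ennreal (J_hat_core (\<sigma> n) (r n) (E n) + (measure lebesgue (E n))\<^sup>2)"
        using elim by (intro interaction_le_J_hat_core[OF E(1) \<sigma>(1) \<sigma>(2) r(1) _ h]) auto
      also have "\<dots> \<le> ennreal (max 0 (C + V\<^sup>2))"
        using J[of n] V[of n] by (intro ennreal_leI) (auto simp: le_max_iff_disj intro!: add_mono power_mono)
      finally show ?case .
    qed
  qed
  obtain \<phi> F where "strict_mono (\<phi> :: nat \<Rightarrow> nat)" "F \<in> lmeasurable"
    "(\<lambda>k. LINT x|lebesgue. \<bar>indicat_real (E (\<phi> k)) x - indicat_real F x\<bar>) \<longlonglongrightarrow> 0"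
    by (rule interaction_bounded_imp_convergent_subseq[OF E(1) ES S _ energy]) auto
  then show ?thesis by blast
qed

lemma J_hat_eq_J_hat_core: "J_hat \<sigma> E = J_hat_core \<sigma> 0 E"
  by (simp add: J_hat_def J_hat_core_def gamma_coeff_def) \<comment> \<open>\<open>0 powr (-\<sigma>) = 0\<close> and \<open>ball x 0 = {}\<close>\<close>

theorem theorem5p3:
  fixes \<sigma> r :: "nat \<Rightarrow> real" and U :: "'a::euclidean_space set"
    and E :: "nat \<Rightarrow> 'a set" and C :: real
  assumes "\<And>n. \<sigma> n \<in> {- real DIM('a)<..<0}"
    and "\<And>n. r n \<in> {0<..}"
    and "filterlim \<sigma> (at_left 0) sequentially"
    and "filterlim r (at_right 0) sequentially"
    and "open U" and "bounded U"
    and "\<And>n. E n \<in> lmeasurable"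
    and "\<And>n. E n \<subseteq> U"
    and "C > 0"
  shows "((\<forall>n. J_hat_core (\<sigma> n) (r n) (E n) \<le> C) \<longrightarrow>
           (\<exists>\<phi> F. strict_mono (\<phi> :: nat \<Rightarrow> nat) \<and> F \<in> lmeasurable \<and>
              (\<lambda>k. LINT x|lebesgue. \<bar>indicat_real (E (\<phi> k)) x - indicat_real F x\<bar>) \<longlonglongrightarrow> 0)) \<and>
         ((\<forall>n. J_hat (\<sigma> n) (E n) \<le> C) \<longrightarrow>
           (\<exists>\<phi> F. strict_mono (\<phi> :: nat \<Rightarrow> nat) \<and> F \<in> lmeasurable \<and>
              (\<lambda>k. LINT x|lebesgue. \<bar>indicat_real (E (\<phi> k)) x - indicat_real F x\<bar>) \<longlonglongrightarrow> 0))"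
proof -
  have \<sigma>: "- real DIM('a) < \<sigma> n" "\<sigma> n < 0" for n using assms(1)[of n] by auto
  have r: "0 \<le> r n" for n using assms(2)[of n] by auto
  have lim: "\<sigma> \<longlonglongrightarrow> 0" "r \<longlonglongrightarrow> 0" using assms(3,4) by (auto simp: filterlim_at)
  show ?thesis
  proof (intro conjI impI, goal_cases)
    case 1
    then show ?case
      by (intro J_hat_core_bounded_imp_convergent_subseq[where \<sigma> = \<sigma> and r = r and U = U and C = C])
        (use \<sigma> r lim assms(6-8) in blast)+
  next
    case 2
    then have "J_hat_core (\<sigma> n) 0 (E n) \<le> C" for n
      by (simp add: J_hat_eq_J_hat_core)
    then show ?case
      by (intro J_hat_core_bounded_imp_convergent_subseq[where \<sigma> = \<sigma> and r = "\<lambda>_. 0" and U = U and C = C])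
        (use \<sigma> lim assms(6-8) in \<open>blast intro: tendsto_const order_refl\<close>)+
  qed
qed

end
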